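(* Let $G$ be a connected graph. For a linear ordering $\sigma$ of $V(G)$ and a vertex $v$, let $$f_\sigma(v)=|N(v)\cap\{u:\sigma(u)>\sigma(v)\}|-|N(v)\cap\{u:\sigma(u)<\sigma(v)\}|,$$ where $N(v)$ is the neighbourhood of $v$ and $\sigma(u)<\sigma(v)$ means $u$ precedes $v$. (i) If $G$ has at least one vertex of odd degree, then there exists an ordering $\sigma$ such that $f_\sigma(v)\ne 0$ for every vertex $v$. (ii) If all degrees in $G$ are even, then there exists an ordering $\sigma$ such that $f_\sigma(v)\neq 0$ for all but at most one vertex $v$; moreover, the vertex (if any) with $f_\sigma(v)=0$ can be prescribed to be any arbitrary vertex of $G$.
   Context: Graphs are finite, undirected, simple. *)

theory Defs
  imports "Graph_Theory.Graph_Theory"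
begin

text \<open>
  Finite simple undirected graphs are the symmetric digraphs of the locale \<^locale>\<open>graph\<close>,
  where each edge is represented by its two opposite arcs.
\<close>

definition nbhd :: "('a, 'b) pre_digraph \<Rightarrow> 'a \<Rightarrow> 'a set" where
  "nbhd G v = {u. v \<rightarrow>\<^bsub>G\<^esub> u}"

definition deg :: "('a, 'b) pre_digraph \<Rightarrow> 'a \<Rightarrow> nat" where
  "deg G v = card (nbhd G v)"

text \<open>A linear ordering is given by the position \<open>\<sigma> v\<close> of every vertex \<open>v\<close>.\<close>

definition vertex_ordering :: "('a, 'b) pre_digraph \<Rightarrow> ('a \<Rightarrow> nat) \<Rightarrow> bool" where
  "vertex_ordering G \<sigma> \<longleftrightarrow> bij_betw \<sigma> (verts G) {1..card (verts G)}"

definition imbalance :: "('a, 'b) pre_digraph \<Rightarrow> ('a \<Rightarrow> nat) \<Rightarrow> 'a \<Rightarrow> int" where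
  "imbalance G \<sigma> v =
     int (card (nbhd G v \<inter> {u. \<sigma> u > \<sigma> v})) - int (card (nbhd G v \<inter> {u. \<sigma> u < \<sigma> v}))"

end

theory Submission
  imports Defs
begin

text \<open>
  Fix a vertex \<open>w\<close> and place the other vertices in order of decreasing distance from \<open>w\<close>, each
  one at the outermost free position either on the left or on the right. When \<open>v\<close> is placed, some
  neighbour of \<open>v\<close> (one closer to \<open>w\<close>) is still unplaced, so the imbalances resulting from the two
  choices differ by twice a positive number and one of them is nonzero. Hence only \<open>w\<close>, placed
  last, can be balanced; and an odd-degree vertex is never balanced.
\<close>

text \<open>
  The set \<open>U\<close> consists of the unplaced vertices, and \<open>c v\<close> is the contribution to the imbalance
  of \<open>v\<close> of the vertices placed so far.
\<close>

lemma ex_list_unbalanced_except: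
  fixes N :: "'a \<Rightarrow> 'a set" and d :: "'a \<Rightarrow> nat" and c :: "'a \<Rightarrow> int"
  assumes "finite U"
    and "\<And>v. v \<in> U \<Longrightarrow> v \<noteq> w \<Longrightarrow> \<exists>u \<in> N v \<inter> U. d u < d v"
  shows "\<exists>xs. distinct xs \<and> set xs = U \<and>
    (\<forall>as v bs. xs = as @ v # bs \<longrightarrow> v \<noteq> w \<longrightarrow>
      c v + int (card (N v \<inter> set bs)) - int (card (N v \<inter> set as)) \<noteq> 0)"
  using assms
proof (induction U arbitrary: c rule: finite_psubset_induct)
  case (psubset U)
  show ?case
  proof (cases "U - {w} = {}")
    case True
    then consider "U = {}" | "U = {w}" by blast
    then show ?thesis
    proof cases
      case 1
      then show ?thesis by (intro exI[of _ "[]"]) simp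
    next
      case 2
      then show ?thesis by (intro exI[of _ "[w]"]) (auto simp: Cons_eq_append_conv)
    qed
  next
    case False
    \<comment> \<open>\<open>v\<close> is chosen farthest from \<open>w\<close>, that is with
      \<open>d\<close> maximal, so it is never the closer neighbour that another vertex relies on.
      The hypothesis on \<open>N\<close> and \<open>d\<close> therefore survives the removal of
      \<open>v\<close>.\<close>
    have fin: "finite (d ` (U - {w}))" using psubset.hyps by simp
    have "Max (d ` (U - {w})) \<in> d ` (U - {w})"
      using fin False by (intro Max_in) auto
    then obtain v where dv: "Max (d ` (U - {w})) = d v" and "v \<in> U - {w}" by (rule imageE)
    then have v: "v \<in> U" "v \<noteq> w" by auto
    have v_max: "d u \<le> d v" if "u \<in> U" "u \<noteq> w" for u
      unfolding dv[symmetric] using that fin by (intro Max_ge) auto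
    let ?U = "U - {v}"
    have step: "\<exists>u' \<in> N u \<inter> ?U. d u' < d u" if u: "u \<in> ?U" "u \<noteq> w" for u
    proof -
      obtain u' where "u' \<in> N u \<inter> U" "d u' < d u"
        using psubset.prems[of u] u by blast
      moreover have "u' \<noteq> v" using v_max[of u] u \<open>d u' < d u\<close> by auto
      ultimately show ?thesis by blast
    qed
    \<comment> \<open>\<open>c'\<close> stays arbitrary because placing \<open>v\<close> changes the
      contributions to the remaining vertices, in a way that depends on the side chosen.\<close>
    have IH: "\<exists>xs. distinct xs \<and> set xs = ?U \<and>
      (\<forall>as v bs. xs = as @ v # bs \<longrightarrow> v \<noteq> w \<longrightarrow>
        c' v + int (card (N v \<inter> set bs)) - int (card (N v \<inter> set as)) \<noteq> 0)" for c'
    proof (rule psubset.IH)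
      show "?U \<subset> U" using v(1) by blast
    qed (rule step)
    obtain u where "u \<in> N v \<inter> U" "d u < d v"
      using psubset.prems[OF v] by blast
    then have "u \<in> N v \<inter> ?U" by auto
    then have pos: "card (N v \<inter> ?U) > 0"
      using psubset.hyps by (auto simp: card_gt_0_iff)
    have card_insert_v: "int (card (N u \<inter> insert v S)) = of_bool (v \<in> N u) + int (card (N u \<inter> S))"
      if "v \<notin> S" "finite S" for u S
      using that by auto
    \<comment> \<open>On the left end \<open>v\<close> would get
      \<open>c v + card (N v \<inter> ?U)\<close>, on the right end
      \<open>c v - card (N v \<inter> ?U)\<close>. If the first is zero, the second is
      \<open>-2 * card (N v \<inter> ?U)\<close>, which is nonzero by \<open>pos\<close>.\<close>
    show ?thesis
    proof (cases "c v + int (card (N v \<inter> ?U)) = 0")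
      case False
      \<comment> \<open>Put in front, \<open>v\<close> precedes every remaining vertex
        \<open>u\<close> and so contributes -1 whenever \<open>v \<in> N u\<close>.
        \<open>card_insert_v\<close> turns this correction back into a count over the extended
        list.\<close>
      obtain xs where xs: "distinct xs" "set xs = ?U"
        and unb: "\<And>as u bs. xs = as @ u # bs \<Longrightarrow> u \<noteq> w \<Longrightarrow>
          c u - of_bool (v \<in> N u) + int (card (N u \<inter> set bs)) - int (card (N u \<inter> set as)) \<noteq> 0"
        using IH[of "\<lambda>u. c u - of_bool (v \<in> N u)"] by blast
      have "c u + int (card (N u \<inter> set bs)) - int (card (N u \<inter> set as)) \<noteq> 0"
        if eq: "v # xs = as @ u # bs" and "u \<noteq> w" for as u bs
      proof (cases as)
        case Nil
        then show ?thesis using eq xs False by simp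
      next
        case (Cons a as')
        then have xs_eq: "xs = as' @ u # bs" and "a = v" using eq by auto
        have "v \<notin> set as'" using xs xs_eq by auto
        then show ?thesis
          using unb[OF xs_eq \<open>u \<noteq> w\<close>] card_insert_v[of "set as'" u] Cons \<open>a = v\<close> by simp
      qed
      moreover have "distinct (v # xs)" "set (v # xs) = U" using xs v by auto
      ultimately show ?thesis by blast
    next
      case True
      \<comment> \<open>Put at the end, \<open>v\<close> succeeds every remaining vertex, so the
        correction is +1.\<close>
      obtain xs where xs: "distinct xs" "set xs = ?U"
        and unb: "\<And>as u bs. xs = as @ u # bs \<Longrightarrow> u \<noteq> w \<Longrightarrow>
          c u + of_bool (v \<in> N u) + int (card (N u \<inter> set bs)) - int (card (N u \<inter> set as)) \<noteq> 0"
        using IH[of "\<lambda>u. c u + of_bool (v \<in> N u)"] by blast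
      have "c u + int (card (N u \<inter> set bs)) - int (card (N u \<inter> set as)) \<noteq> 0"
        if eq: "xs @ [v] = as @ u # bs" and "u \<noteq> w" for as u bs
      proof (cases bs rule: rev_cases)
        case Nil
        then show ?thesis using eq xs True pos by simp
      next
        case (snoc bs' b)
        then have xs_eq: "xs = as @ u # bs'" and "b = v" using eq by auto
        have "v \<notin> set bs'" using xs xs_eq by auto
        then show ?thesis
          using unb[OF xs_eq \<open>u \<noteq> w\<close>] card_insert_v[of "set bs'" u] snoc \<open>b = v\<close> by simp
      qed
      moreover have "distinct (xs @ [v])" "set (xs @ [v]) = U" using xs v by auto
      ultimately show ?thesis by blast
    qed
  qed
qed

lemma ex_vertex_ordering_of_list:
  assumes "distinct xs" and "set xs = verts G"
  shows "\<exists>\<sigma>. vertex_ordering G \<sigma> \<and>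
    (\<forall>as v bs. xs = as @ v # bs \<longrightarrow>
      {u \<in> verts G. \<sigma> u > \<sigma> v} = set bs \<and> {u \<in> verts G. \<sigma> u < \<sigma> v} = set as)"
proof -
  let ?n = "length xs"
  \<comment> \<open>List indices start at 0 but positions at 1, hence the
    \<open>Suc\<close>.\<close>
  define \<sigma> where "\<sigma> = Suc \<circ> inv_into {..<?n} ((!) xs)"
  have bij: "bij_betw ((!) xs) {..<?n} (verts G)"
    using bij_betw_nth[of xs] assms by auto
  have n: "card (verts G) = ?n"
    using assms distinct_card by fastforce
  have "bij_betw (Suc \<circ> inv_into {..<?n} ((!) xs)) (verts G) {1..?n}"
    using bij_betw_inv_into[OF bij]
    by (rule bij_betw_trans) (auto simp: bij_betw_def image_Suc_lessThan)
  then have "vertex_ordering G \<sigma>"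
    by (simp add: vertex_ordering_def n \<sigma>_def)
  moreover have \<sigma>_nth: "\<sigma> (xs ! i) = Suc i" if "i < ?n" for i
    using that bij by (auto simp: \<sigma>_def bij_betw_def)
  have "{u \<in> verts G. \<sigma> u > \<sigma> v} = set bs \<and> {u \<in> verts G. \<sigma> u < \<sigma> v} = set as"
    if xs: "xs = as @ v # bs" for as v bs
  proof -
    have v: "\<sigma> v = Suc (length as)" using \<sigma>_nth[of "length as"] xs by simp
    have as: "\<sigma> u < \<sigma> v" if u: "u \<in> set as" for u
    proof -
      obtain i where "i < length as" "u = as ! i" using u by (metis in_set_conv_nth)
      then show ?thesis using \<sigma>_nth[of i] xs v by (simp add: nth_append)
    qed
    have bs: "\<sigma> u > \<sigma> v" if u: "u \<in> set bs" for u
    proof -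
      obtain i where "i < length bs" "u = bs ! i" using u by (metis in_set_conv_nth)
      then show ?thesis using \<sigma>_nth[of "Suc (length as + i)"] xs v by (simp add: nth_append)
    qed
    have "verts G = set as \<union> {v} \<union> set bs" using assms(2) xs by auto
    then show ?thesis using as bs by (auto dest: less_asym)
  qed
  ultimately show ?thesis by blast
qed

context graph
begin

lemma nbhd_subset_verts: "nbhd G v \<subseteq> verts G"
  by (auto simp: nbhd_def dest: adj_in_verts)

text \<open>The witness is the length of a shortest walk to \<open>w\<close>, which exists by
  connectedness. For \<open>v \<noteq> w\<close> that walk has a first step, and it leads to a
  vertex with a shorter walk.\<close>

lemma ex_distance_function:
  assumes "connected G" and "w \<in> verts G"
  shows "\<exists>d :: 'a \<Rightarrow> nat. \<forall>v \<in> verts G. v \<noteq> w \<longrightarrow> (\<exists>u \<in> nbhd G v. d u < d v)"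
proof -
  define d where "d v = (LEAST n. (v, w) \<in> arcs_ends G ^^ n)" for v
  have "\<exists>u \<in> nbhd G v. d u < d v" if v: "v \<in> verts G" "v \<noteq> w" for v
  proof -
    have "v \<rightarrow>\<^sup>* w"
      using symmetric_connected_imp_strongly_connected[OF sym_arcs assms(1)] v(1) assms(2) by blast
    then obtain n where "(v, w) \<in> arcs_ends G ^^ n"
      using reachable_rtranclI rtrancl_imp_relpow by metis
    then have path: "(v, w) \<in> arcs_ends G ^^ d v"
      unfolding d_def by (rule LeastI)
    then obtain m where m: "d v = Suc m"
      using v(2) by (cases "d v") auto
    obtain u where u: "v \<rightarrow> u" "(u, w) \<in> arcs_ends G ^^ m"
      using path unfolding m by (meson relpow_Suc_D2)
    have "d u \<le> m" using u(2) unfolding d_def by (rule Least_le)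
    then show ?thesis using u(1) m by (auto simp: nbhd_def)
  qed
  then show ?thesis by blast
qed

lemma ex_ordering_unbalanced_except:
  assumes "connected G" and "w \<in> verts G"
  shows "\<exists>\<sigma>. vertex_ordering G \<sigma> \<and> (\<forall>v \<in> verts G. imbalance G \<sigma> v = 0 \<longrightarrow> v = w)"
proof -
  obtain d :: "'a \<Rightarrow> nat" where d: "\<And>v. v \<in> verts G \<Longrightarrow> v \<noteq> w \<Longrightarrow> \<exists>u \<in> nbhd G v. d u < d v"
    using ex_distance_function[OF assms] by blast
  have "\<exists>u \<in> nbhd G v \<inter> verts G. d u < d v" if "v \<in> verts G" "v \<noteq> w" for v
    using d[OF that] nbhd_subset_verts by blast
  \<comment> \<open>The contributions \<open>c\<close> start at 0, since no vertex has been placed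
    yet.\<close>
  from ex_list_unbalanced_except[of "verts G" w "nbhd G" d "\<lambda>_. 0", OF finite_verts this]
  obtain xs where xs: "distinct xs" "set xs = verts G"
    and unb: "\<And>as v bs. xs = as @ v # bs \<Longrightarrow> v \<noteq> w \<Longrightarrow>
      int (card (nbhd G v \<inter> set bs)) - int (card (nbhd G v \<inter> set as)) \<noteq> 0"
    by auto
  obtain \<sigma> where \<sigma>: "vertex_ordering G \<sigma>"
    and parts: "\<And>as v bs. xs = as @ v # bs \<Longrightarrow>
      {u \<in> verts G. \<sigma> u > \<sigma> v} = set bs \<and> {u \<in> verts G. \<sigma> u < \<sigma> v} = set as"
    using ex_vertex_ordering_of_list[OF xs] by blast
  have "imbalance G \<sigma> v \<noteq> 0" if "v \<in> verts G" "v \<noteq> w" for v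
  proof -
    obtain as bs where eq: "xs = as @ v # bs"
      using \<open>v \<in> verts G\<close> xs(2) by (metis split_list)
    \<comment> \<open>\<open>imbalance\<close> ranges over all \<open>u\<close> of the type, where
      \<open>\<sigma>\<close> is unconstrained outside \<open>verts G\<close>; intersecting with the
      neighbourhood discards those values.\<close>
    have "nbhd G v \<inter> {u. \<sigma> u > \<sigma> v} = nbhd G v \<inter> set bs"
      "nbhd G v \<inter> {u. \<sigma> u < \<sigma> v} = nbhd G v \<inter> set as"
      using parts[OF eq] nbhd_subset_verts[of v] by blast+
    then show ?thesis
      using unb[OF eq \<open>v \<noteq> w\<close>] by (simp add: imbalance_def)
  qed
  then show ?thesis using \<sigma> by blast
qed

text \<open>Later and earlier neighbours partition the neighbourhood, because there are no loops and
  positions are distinct. Equal halves would make the degree even.\<close>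

lemma odd_deg_imp_imbalance_nonzero:
  assumes "vertex_ordering G \<sigma>" and "v \<in> verts G" and "odd (deg G v)"
  shows "imbalance G \<sigma> v \<noteq> 0"
proof
  let ?A = "nbhd G v \<inter> {u. \<sigma> u > \<sigma> v}" and ?B = "nbhd G v \<inter> {u. \<sigma> u < \<sigma> v}"
  assume "imbalance G \<sigma> v = 0"
  then have eq: "card ?A = card ?B" by (simp add: imbalance_def)
  have "v \<notin> nbhd G v"
    using adj_not_same by (auto simp: nbhd_def)
  moreover have "inj_on \<sigma> (verts G)"
    using assms(1) by (simp add: vertex_ordering_def bij_betw_def)
  ultimately have "\<sigma> u \<noteq> \<sigma> v" if "u \<in> nbhd G v" for u
    using that nbhd_subset_verts assms(2) by (metis inj_onD subsetD)
  then have "nbhd G v = ?A \<union> ?B" by (auto simp: neq_iff)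
  then have "deg G v = card (?A \<union> ?B)" unfolding deg_def by (rule arg_cong)
  also have "\<dots> = card ?A + card ?B"
    using finite_subset[OF nbhd_subset_verts finite_verts, of v] by (intro card_Un_disjoint) auto
  finally have "deg G v = card ?A + card ?B" .
  then show False using assms(3) eq by simp
qed

end

theorem theorem2:
  fixes G :: "('a, 'b) pre_digraph"
  assumes "graph G" and "Digraph_Component.connected G"
  shows "((\<exists>v \<in> verts G. odd (deg G v)) \<longrightarrow>
           (\<exists>\<sigma>. vertex_ordering G \<sigma> \<and> (\<forall>v \<in> verts G. imbalance G \<sigma> v \<noteq> 0)))
       \<and> ((\<forall>v \<in> verts G. even (deg G v)) \<longrightarrow>
           (\<exists>\<sigma>. vertex_ordering G \<sigma> \<and> card {v \<in> verts G. imbalance G \<sigma> v = 0} \<le> 1) \<and>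
           (\<forall>w \<in> verts G. \<exists>\<sigma>. vertex_ordering G \<sigma> \<and>
              (\<forall>v \<in> verts G. imbalance G \<sigma> v = 0 \<longrightarrow> v = w)))"
proof -
  interpret graph G by fact
  note prescribed = ex_ordering_unbalanced_except[OF assms(2)]
  \<comment> \<open>The only possible exception is placed at a vertex of odd degree, where parity
    rules it out.\<close>
  have "\<exists>\<sigma>. vertex_ordering G \<sigma> \<and> (\<forall>v \<in> verts G. imbalance G \<sigma> v \<noteq> 0)"
    if "w \<in> verts G" "odd (deg G w)" for w
    using prescribed[OF that(1)] odd_deg_imp_imbalance_nonzero[OF _ that] by blast
  moreover have "\<exists>\<sigma>. vertex_ordering G \<sigma> \<and> card {v \<in> verts G. imbalance G \<sigma> v = 0} \<le> 1"
  proof -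
    \<comment> \<open>Connectedness includes having at least one vertex.\<close>
    obtain w where "w \<in> verts G"
      using assms(2) by (auto simp: connected_def strongly_connected_def)
    from prescribed[OF this] obtain \<sigma> where "vertex_ordering G \<sigma>"
      and sub: "{v \<in> verts G. imbalance G \<sigma> v = 0} \<subseteq> {w}" by blast
    moreover have "card {v \<in> verts G. imbalance G \<sigma> v = 0} \<le> 1"
      using card_mono[OF _ sub] by simp
    ultimately show ?thesis by blast
  qed
  ultimately show ?thesis using prescribed by blast
qed

end
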